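(* Let $\mathfrak{c}$ denote the cardinality of the continuum. There exists a dense subgroup of $\mathbb{Z}_2^{2^{\mathfrak{c}}}$ which (with the subspace topology) is strongly $(\beta\mathbb{N}\setminus\mathbb{N})$-pseudocompact and contains no non-trivial convergent sequences.
   Context: $\mathbb{Z}_2$ is the two-element group with the discrete topology, and powers of $\mathbb{Z}_2$ carry the product topology. $\beta\mathbb{N}\setminus\mathbb{N}$ is identified with the set of all free (non-principal) ultrafilters on $\mathbb{N}$. For a free ultrafilter $p$ on $\mathbb{N}$, a point $x$ of a space $X$ is a $p$-limit of a sequence $\{x_n:n\in\mathbb{N}\}$ of points of $X$ if $\{n\in\mathbb{N}:x_n\in V\}\in p$ for every neighbourhood $V$ of $x$ in $X$. A space $X$ is strongly $p$-pseudocompact if for every sequence $\{U_n:n\in\mathbb{N}\}$ of non-empty open subsets of $X$ one can choose a point $x_n\in U_n$ for each $n\in\mathbb{N}$ in such a way that the sequence $\{x_n:n\in\mathbb{N}\}$ has a $p$-limit in $X$. A space is strongly $(\beta\mathbb{N}\setminus\mathbb{N})$-pseudocompact if it is strongly $p$-pseudocompact for every free ultrafilter $p$ on $\mathbb{N}$. A convergent sequence is non-trivial if it is not eventually constant. *)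

theory Defs
  imports "HOL-Analysis.Analysis" "HOL-Algebra.Product_Groups"
begin

abbreviation Z2_group :: "int monoid" where
  "Z2_group \<equiv> integer_mod_group 2"

abbreviation Z2_power_group :: "'i set \<Rightarrow> ('i \<Rightarrow> int) monoid" where
  "Z2_power_group I \<equiv> product_group I (\<lambda>_. Z2_group)"

abbreviation Z2_power_top :: "'i set \<Rightarrow> ('i \<Rightarrow> int) topology" where
  "Z2_power_top I \<equiv> product_topology (\<lambda>_. discrete_topology (carrier Z2_group)) I"

text \<open>
  An ultrafilter on the natural numbers is a value of the type \<open>nat filter\<close>: a set
  \<open>A\<close> belongs to \<open>p\<close> iff \<open>eventually (\<lambda>n. n \<in> A) p\<close>. The library's filters may be
  improper, hence the condition \<open>p \<noteq> bot\<close>.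
\<close>

definition free_ultrafilter :: "nat filter \<Rightarrow> bool" where
  "free_ultrafilter p \<longleftrightarrow>
     p \<noteq> bot \<and>
     (\<forall>A. eventually (\<lambda>n. n \<in> A) p \<or> eventually (\<lambda>n. n \<notin> A) p) \<and>
     (\<forall>m. p \<noteq> principal {m})"

text \<open>
  \<open>limitin X x l p\<close> unfolds to: \<open>l\<close> is a point of \<open>X\<close> and \<open>{n. x n \<in> V}\<close> belongs to \<open>p\<close>
  for every open \<open>V\<close> containing \<open>l\<close>; so it says that \<open>l\<close> is a \<open>p\<close>-limit of \<open>x\<close> in \<open>X\<close>.
\<close>

definition strongly_p_pseudocompact :: "nat filter \<Rightarrow> 'a topology \<Rightarrow> bool" where
  "strongly_p_pseudocompact p X \<longleftrightarrow>
     (\<forall>U :: nat \<Rightarrow> 'a set. (\<forall>n. openin X (U n) \<and> U n \<noteq> {}) \<longrightarrow>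
        (\<exists>x. (\<forall>n. x n \<in> U n) \<and> (\<exists>l. limitin X x l p)))"

definition strongly_free_pseudocompact :: "'a topology \<Rightarrow> bool" where
  "strongly_free_pseudocompact X \<longleftrightarrow>
     (\<forall>p. free_ultrafilter p \<longrightarrow> strongly_p_pseudocompact p X)"

definition has_nontrivial_convergent_sequence :: "'a topology \<Rightarrow> bool" where
  "has_nontrivial_convergent_sequence X \<longleftrightarrow>
     (\<exists>(x :: nat \<Rightarrow> 'a) l. (\<forall>n. x n \<in> topspace X) \<and> limitin X x l sequentially \<and>
        \<not> (\<exists>c. eventually (\<lambda>n. x n = c) sequentially))"

end

theory Submission
  imports Defs
begin

text \<open>
  For every sequence \<open>U\<close> of basic open sets take a copy of \<open>\<beta>\<nat>\<close>, and let the group be the image of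
  the free Boolean group over all these copies under homomorphisms that are continuous on each
  copy, one for every coordinate. Such a homomorphism is given by arbitrary values on the points
  \<open>(U, n)\<close>. Requiring that the image of \<open>(U, n)\<close> lies in the \<open>n\<close>-th member of \<open>U\<close> prescribes some of
  these values; then the image of \<open>(U, p)\<close> is a \<open>p\<close>-limit of a selection from \<open>U\<close>, and the
  group is dense. There are as many sequences in the free group as coordinates, and each \<open>U\<close>
  restricts only countably many coordinates, so every sequence can be given a coordinate at which the
  homomorphism is free on all the copies involved. It remains to see that a sequence that is not
  eventually constant is mapped to a non-convergent one by some such homomorphism: given
  finite sets \<open>d n\<close> of ultrafilters, infinitely many of them nonempty, there is a set \<open>A\<close> that
  belongs to an odd number of members of \<open>d n\<close> for infinitely many \<open>n\<close>. This is a gliding hump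
  argument.
\<close>

section \<open>Ultrafilters on an arbitrary type\<close>

text \<open>Principal ultrafilters are included, since \<open>principal {n}\<close> stands for the
  point \<open>n\<close> of a copy of \<beta>\<nat>. The type is arbitrary because all copies are
  later merged into ultrafilters on pairs.\<close>

definition ultrafilter :: "'a filter \<Rightarrow> bool" where
  "ultrafilter p \<longleftrightarrow> p \<noteq> bot \<and> (\<forall>A. eventually (\<lambda>x. x \<in> A) p \<or> eventually (\<lambda>x. x \<notin> A) p)"

lemma ultrafilter_not:
  assumes "ultrafilter p"
  shows "eventually (\<lambda>x. \<not> P x) p \<longleftrightarrow> \<not> eventually P p"
proof
  assume "\<not> eventually P p"
  then show "eventually (\<lambda>x. \<not> P x) p"
    using assms[unfolded ultrafilter_def, THEN conjunct2, rule_format, of "{x. P x}"] by simp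
next
  assume *: "eventually (\<lambda>x. \<not> P x) p"
  show "\<not> eventually P p"
  proof
    assume "eventually P p"
    with * have "eventually (\<lambda>x. False) p" by eventually_elim simp
    with assms show False by (simp add: ultrafilter_def)
  qed
qed

lemma ultrafilter_disj:
  assumes "ultrafilter p"
  shows "eventually (\<lambda>x. P x \<or> Q x) p \<longleftrightarrow> eventually P p \<or> eventually Q p"
proof -
  have "\<not> eventually (\<lambda>x. P x \<or> Q x) p \<longleftrightarrow> eventually (\<lambda>x. \<not> P x \<and> \<not> Q x) p"
    by (simp flip: ultrafilter_not[OF assms])
  also have "\<dots> \<longleftrightarrow> \<not> eventually P p \<and> \<not> eventually Q p"
    by (simp add: eventually_conj_iff ultrafilter_not[OF assms])
  finally show ?thesis by blast
qed

lemma ultrafilter_principal: "ultrafilter (principal {x})"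
  by (auto simp: ultrafilter_def eventually_principal principal_eq_bot_iff)

lemma ultrafilter_filtermap: "ultrafilter p \<Longrightarrow> ultrafilter (filtermap f p)"
  by (simp add: ultrafilter_def[of "filtermap f p"] filtermap_bot_iff eventually_filtermap
      ultrafilter_not) (simp add: ultrafilter_def)

lemma free_imp_ultrafilter: "free_ultrafilter p \<Longrightarrow> ultrafilter p"
  by (simp add: free_ultrafilter_def ultrafilter_def)

lemma ultrafilter_separate:
  assumes "ultrafilter p" "ultrafilter q" "p \<noteq> q"
  obtains A where "eventually (\<lambda>x. x \<in> A) p" "\<not> eventually (\<lambda>x. x \<in> A) q"
proof -
  have "\<exists>P. eventually P p \<and> \<not> eventually P q"
    using assms ultrafilter_not by (metis filter_eq_iff)
  then obtain P where "eventually P p" "\<not> eventually P q" by blast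
  then show thesis using that[of "{x. P x}"] by simp
qed

text \<open>Each of the finitely many members of \<open>d\<close> other than \<open>p\<close> is
  separated from \<open>p\<close> by some set; the intersection of these sets works.\<close>

lemma ultrafilter_isolate:
  assumes "finite d" "d \<subseteq> Collect ultrafilter" "ultrafilter p"
  shows "\<exists>A. eventually (\<lambda>x. x \<in> A) p \<and> (\<forall>q\<in>d. eventually (\<lambda>x. x \<in> A) q \<longrightarrow> q = p)"
proof -
  have "\<exists>A. eventually (\<lambda>x. x \<in> A) p \<and> \<not> eventually (\<lambda>x. x \<in> A) q" if "q \<in> d - {p}" for q
  proof -
    have "ultrafilter q" "p \<noteq> q" using that assms(2) by auto
    then show ?thesis using ultrafilter_separate[OF assms(3)] by metis
  qed
  then obtain A where A: "\<And>q. q \<in> d - {p} \<Longrightarrow> eventually (\<lambda>x. x \<in> A q) p"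
    "\<And>q. q \<in> d - {p} \<Longrightarrow> \<not> eventually (\<lambda>x. x \<in> A q) q" by metis
  have "eventually (\<lambda>x. x \<in> (\<Inter>q\<in>d - {p}. A q)) p"
    using A(1) assms(1) by (simp add: eventually_ball_finite)
  moreover have "q = p" if "q \<in> d" "eventually (\<lambda>x. x \<in> (\<Inter>q\<in>d - {p}. A q)) q" for q
  proof (rule ccontr)
    assume "q \<noteq> p"
    with that have "eventually (\<lambda>x. x \<in> A q) q"
      by (auto elim!: eventually_mono)
    with A(2) that \<open>q \<noteq> p\<close> show False by blast
  qed
  ultimately show ?thesis by blast
qed

section \<open>Parity of traces of finite sets of ultrafilters\<close>

text \<open>The trace of \<open>d\<close> on the clopen subset of the space of ultrafilters given by
  \<open>A\<close>.\<close>

definition members :: "'a filter set \<Rightarrow> 'a set \<Rightarrow> 'a filter set" where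
  "members d A = {p \<in> d. eventually (\<lambda>x. x \<in> A) p}"

lemma finite_members [simp]: "finite d \<Longrightarrow> finite (members d A)"
  by (simp add: members_def)

lemma members_mono: "A \<subseteq> B \<Longrightarrow> members d A \<subseteq> members d B"
  by (auto simp: members_def elim: eventually_mono)

lemma members_empty: "d \<subseteq> Collect ultrafilter \<Longrightarrow> members d {} = {}"
  by (auto simp: members_def ultrafilter_def subset_iff)

lemma members_Un:
  "d \<subseteq> Collect ultrafilter \<Longrightarrow> members d (A \<union> B) = members d A \<union> members d B"
  by (auto simp: members_def ultrafilter_disj subset_iff)

lemma members_disjoint:
  assumes "d \<subseteq> Collect ultrafilter" "A \<inter> B = {}"
  shows "members d A \<inter> members d B = {}"
proof -
  have False if "p \<in> d" "eventually (\<lambda>x. x \<in> A) p" "eventually (\<lambda>x. x \<in> B) p" for p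
  proof -
    have "eventually (\<lambda>x. x \<in> A \<and> x \<in> B) p" using that by (simp add: eventually_conj_iff)
    then have "eventually (\<lambda>x. False) p" using assms(2) by (auto elim!: eventually_mono)
    with assms(1) that(1) show False by (auto simp: ultrafilter_def)
  qed
  then show ?thesis by (auto simp: members_def)
qed

lemma card_members_Un:
  assumes "finite d" "d \<subseteq> Collect ultrafilter" "A \<inter> B = {}"
  shows "card (members d (A \<union> B)) = card (members d A) + card (members d B)"
  using assms by (simp add: members_Un members_disjoint card_Un_disjoint)

lemma even_members_UN:
  assumes "finite d" "d \<subseteq> Collect ultrafilter" "finite J" "disjoint_family_on A J"
    "\<And>j. j \<in> J \<Longrightarrow> even (card (members d (A j)))"
  shows "even (card (members d (\<Union>j\<in>J. A j)))"
  using assms(3-5)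
proof (induction J rule: finite_induct)
  case empty
  then show ?case using assms(2) by (simp add: members_empty)
next
  case (insert j J)
  then have "A j \<inter> (\<Union>j\<in>J. A j) = {}" "disjoint_family_on A J"
    by (auto simp: disjoint_family_on_def)
  with insert assms(1,2) show ?case by (simp add: card_members_Un)
qed

section \<open>The gliding hump\<close>

text \<open>Induction on \<open>d\<close>: when \<open>p\<close> is added, two disjoint infinite
  sets are chosen inside the index set found so far. The corresponding unions are disjoint, so one
  of them does not belong to \<open>p\<close>, and shrinking the index set keeps what was achieved
  for the other members.\<close>

lemma infinite_subset_avoiding:
  fixes M :: "nat set"
  assumes "finite d" "d \<subseteq> Collect ultrafilter" "disjoint_family A" "infinite M"
  shows "\<exists>M'\<subseteq>M. infinite M' \<and> members d (\<Union>j\<in>M'. A j) = {}"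
  using assms(1,2)
proof (induction d rule: finite_induct)
  case empty
  then show ?case using assms(4) by (auto simp: members_def)
next
  case (insert p d)
  then obtain M' where M': "M' \<subseteq> M" "infinite M'" "members d (\<Union>j\<in>M'. A j) = {}" by auto
  obtain r :: "nat \<Rightarrow> nat" where r: "strict_mono r" "\<And>n. r n \<in> M'"
    using infinite_enumerate[OF M'(2)] by blast
  define B C where "B = range (\<lambda>n. r (2 * n))" and "C = range (\<lambda>n. r (2 * n + 1))"
  have BC: "infinite B" "infinite C" "B \<inter> C = {}" "B \<union> C \<subseteq> M'"
  proof -
    show "infinite B" "infinite C"
      unfolding B_def C_def using strict_mono_eq[OF r(1)]
      by (auto intro!: range_inj_infinite injI)
    show "B \<inter> C = {}"
      unfolding B_def C_def using strict_mono_eq[OF r(1)] by (auto; presburger)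
    show "B \<union> C \<subseteq> M'" unfolding B_def C_def using r(2) by auto
  qed
  have "A i \<inter> A j = {}" if "i \<in> B" "j \<in> C" for i j
    using that BC(3) assms(3) by (intro disjoint_family_onD[of A UNIV]) auto
  then have "(\<Union>j\<in>B. A j) \<inter> (\<Union>j\<in>C. A j) = {}" by blast
  then have "members {p} (\<Union>j\<in>B. A j) \<inter> members {p} (\<Union>j\<in>C. A j) = {}"
    using insert.prems by (intro members_disjoint) auto
  then have "members {p} (\<Union>j\<in>B. A j) = {} \<or> members {p} (\<Union>j\<in>C. A j) = {}"
    by (auto simp: members_def split: if_splits)
  then obtain D where D: "infinite D" "D \<subseteq> M'" "members {p} (\<Union>j\<in>D. A j) = {}"
    using BC by blast
  have "members d (\<Union>j\<in>D. A j) = {}"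
    using members_mono[of "\<Union>j\<in>D. A j" "\<Union>j\<in>M'. A j" d] D(2) M'(3) by blast
  with D have "members (insert p d) (\<Union>j\<in>D. A j) = {}" by (auto simp: members_def)
  with D M'(1) show ?case by blast
qed

context
  fixes d :: "nat \<Rightarrow> 'a filter set"
  assumes d: "\<And>n. finite (d n)" "\<And>n. d n \<subseteq> Collect ultrafilter"
begin

text \<open>
  Isolating one member of \<open>members (d n) R\<close> cuts \<open>R\<close> into two pieces that are both odd for \<open>d n\<close>;
  infinitely many of the \<open>d k\<close> still meet one of them, which is kept as \<open>R'\<close>.
\<close>

lemma split_off_odd:
  fixes N :: nat
  assumes inf: "\<exists>\<^sub>\<infinity>n. members (d n) R \<noteq> {}"
    and ev: "\<forall>\<^sub>\<infinity>n. even (card (members (d n) R))"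
  obtains n R' where "n > N" "R' \<subseteq> R" "odd (card (members (d n) (R - R')))"
    "\<exists>\<^sub>\<infinity>k. members (d k) R' \<noteq> {}"
proof -
  have "\<exists>\<^sub>\<infinity>n. members (d n) R \<noteq> {} \<and> (even (card (members (d n) R)) \<and> n > N)"
    using inf eventually_conj[OF ev MOST_ge_nat[of "Suc N"]]
    by (rule frequently_rev_mp[OF _ eventually_mono]) auto
  then obtain n where n: "members (d n) R \<noteq> {}" "even (card (members (d n) R))" "n > N"
    using frequently_ex by blast
  then obtain p where p: "p \<in> members (d n) R" by blast
  then have "ultrafilter p" using d(2) by (auto simp: members_def)
  obtain A where A: "eventually (\<lambda>x. x \<in> A) p"
    "\<And>q. q \<in> d n \<Longrightarrow> eventually (\<lambda>x. x \<in> A) q \<Longrightarrow> q = p"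
    using ultrafilter_isolate[OF d \<open>ultrafilter p\<close>] by blast
  have "members (d n) (R \<inter> A) = {p}"
    using p A by (auto simp: members_def eventually_conj_iff)
  then have odd1: "odd (card (members (d n) (R \<inter> A)))" by simp
  have R: "(R \<inter> A) \<union> (R - A) = R" "(R \<inter> A) \<inter> (R - A) = {}" by auto
  have odd2: "odd (card (members (d n) (R - A)))"
    using card_members_Un[OF d R(2)] odd1 n(2) R(1) by simp
  have "members (d k) R = members (d k) (R \<inter> A) \<union> members (d k) (R - A)" for k
    using members_Un[of "d k" "R \<inter> A" "R - A"] d(2) R(1) by simp
  then have "\<exists>\<^sub>\<infinity>k. members (d k) (R \<inter> A) \<noteq> {} \<or> members (d k) (R - A) \<noteq> {}"
    using inf by (simp only: Un_empty de_Morgan_conj)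
  then have "(\<exists>\<^sub>\<infinity>k. members (d k) (R \<inter> A) \<noteq> {}) \<or> (\<exists>\<^sub>\<infinity>k. members (d k) (R - A) \<noteq> {})"
    by (simp only: frequently_disj_iff)
  then show thesis
  proof
    assume "\<exists>\<^sub>\<infinity>k. members (d k) (R \<inter> A) \<noteq> {}"
    moreover have "R - R \<inter> A = R - A" by auto
    ultimately show thesis using that[of n "R \<inter> A"] n odd2 by auto
  next
    assume "\<exists>\<^sub>\<infinity>k. members (d k) (R - A) \<noteq> {}"
    moreover have "R - (R - A) = R \<inter> A" by auto
    ultimately show thesis using that[of n "R - A"] n odd1 by auto
  qed
qed

text \<open>Iterating \<open>split_off_odd\<close> gives a decreasing chain of remainders; the
  pieces are its successive differences, hence disjoint.\<close>

lemma disjoint_odd_pieces: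
  assumes inf: "\<exists>\<^sub>\<infinity>n. d n \<noteq> {}"
    and ev: "\<And>R. \<forall>\<^sub>\<infinity>n. even (card (members (d n) R))"
  shows "\<exists>(\<nu> :: nat \<Rightarrow> nat) A. strict_mono \<nu> \<and> disjoint_family A \<and>
    (\<forall>m. odd (card (members (d (\<nu> m)) (A m))))"
proof -
  \<comment> \<open>A state pairs the last index used with the current remainder.\<close>
  have "\<exists>f. \<forall>m. (\<exists>\<^sub>\<infinity>k. members (d k) (snd (f m)) \<noteq> {}) \<and>
      (fst (f m) < fst (f (Suc m)) \<and> snd (f (Suc m)) \<subseteq> snd (f m) \<and>
       odd (card (members (d (fst (f (Suc m)))) (snd (f m) - snd (f (Suc m))))))"
  proof (rule dependent_nat_choice)
    show "\<exists>x :: nat \<times> 'a set. \<exists>\<^sub>\<infinity>k. members (d k) (snd x) \<noteq> {}"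
      using inf by (intro exI[of _ "(0, UNIV)"]) (simp add: members_def)
  next
    fix x :: "nat \<times> 'a set" and m :: nat
    assume "\<exists>\<^sub>\<infinity>k. members (d k) (snd x) \<noteq> {}"
    then obtain n R' where
      "fst x < n" "R' \<subseteq> snd x" "odd (card (members (d n) (snd x - R')))"
      "\<exists>\<^sub>\<infinity>k. members (d k) R' \<noteq> {}"
      by (rule split_off_odd[OF _ ev])
    then show "\<exists>y. (\<exists>\<^sub>\<infinity>k. members (d k) (snd y) \<noteq> {}) \<and>
        fst x < fst y \<and> snd y \<subseteq> snd x \<and>
        odd (card (members (d (fst y)) (snd x - snd y)))"
      by (intro exI[of _ "(n, R')"]) simp
  qed
  then obtain f where
    f: "\<And>m. fst (f m) < fst (f (Suc m))" "\<And>m. snd (f (Suc m)) \<subseteq> snd (f m)"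
      "\<And>m. odd (card (members (d (fst (f (Suc m)))) (snd (f m) - snd (f (Suc m)))))" by blast
  show ?thesis
  proof (intro exI conjI allI)
    show "strict_mono (\<lambda>m. fst (f (Suc m)))" using f(1) by (simp add: strict_mono_Suc_iff)
    have anti: "snd (f n) \<subseteq> snd (f m)" if "m \<le> n" for m n
      by (rule lift_Suc_antimono_le[of "\<lambda>m. snd (f m)", OF f(2) that])
    have "(snd (f m) - snd (f (Suc m))) \<inter> (snd (f n) - snd (f (Suc n))) = {}" if "m < n" for m n
      using anti[of "Suc m" n] that by auto
    then show "disjoint_family (\<lambda>m. snd (f m) - snd (f (Suc m)))"
      unfolding disjoint_family_on_def by (metis Int_commute linorder_neqE_nat)
  qed (rule f(3))
qed

text \<open>Otherwise every set is even for almost all \<open>d n\<close>. Applied to the disjoint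
  odd pieces, this allows picking infinitely many of them such that at each picked index only its
  own piece counts oddly. Their union is then odd infinitely often, a contradiction.\<close>

proposition infinitely_often_odd:
  assumes inf: "\<exists>\<^sub>\<infinity>n. d n \<noteq> {}"
  shows "\<exists>A. \<exists>\<^sub>\<infinity>n. odd (card (members (d n) A))"
proof (rule ccontr)
  assume none: "\<not> ?thesis"
  have ev: "\<forall>\<^sub>\<infinity>n. even (card (members (d n) R))" for R
    using none[simplified, rule_format, of R] by (simp add: frequently_def)
  obtain \<nu> :: "nat \<Rightarrow> nat" and A where \<nu>: "strict_mono \<nu>" and A: "disjoint_family A"
    and odd: "\<And>m. odd (card (members (d (\<nu> m)) (A m)))"
    using disjoint_odd_pieces[OF inf ev] by blast
  have ev\<nu>: "\<forall>\<^sub>\<infinity>m. even (card (members (d (\<nu> m)) R))" for R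
    using ev[of R] filterlim_subseq[OF \<nu>] unfolding cofinite_eq_sequentially
    by (rule eventually_compose_filterlim)
  \<comment> \<open>A state pairs the last index picked with an infinite set of candidates for later
    picks. The first pick is made in passing from \<open>f 0\<close> to \<open>f 1\<close>, hence
    the shift in \<open>K\<close> and \<open>M\<close>.\<close>
  have "\<exists>f. \<forall>m. infinite (snd (f m)) \<and>
      (fst (f (Suc m)) \<in> snd (f m) \<and> snd (f (Suc m)) \<subseteq> snd (f m) - {..fst (f (Suc m))} \<and>
       members (d (\<nu> (fst (f (Suc m))))) (\<Union>j\<in>snd (f (Suc m)). A j) = {} \<and>
       (\<forall>j\<in>snd (f (Suc m)). even (card (members (d (\<nu> j)) (A (fst (f (Suc m))))))))"
  proof (rule dependent_nat_choice)
    show "\<exists>x :: nat \<times> nat set. infinite (snd x)"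
      by (intro exI[of _ "(0, UNIV)"]) simp
  next
    fix x :: "nat \<times> nat set" and m :: nat
    assume M: "infinite (snd x)"
    then obtain k where k: "k \<in> snd x" by (metis ex_in_conv finite.emptyI)
    have "finite {j. odd (card (members (d (\<nu> j)) (A k)))}"
      using ev\<nu>[of "A k"] by (simp add: eventually_cofinite)
    then have "infinite (snd x - {..k} - {j. odd (card (members (d (\<nu> j)) (A k)))})"
      using M by simp
    then obtain M' where "M' \<subseteq> snd x - {..k} - {j. odd (card (members (d (\<nu> j)) (A k)))}"
      "infinite M'" "members (d (\<nu> k)) (\<Union>j\<in>M'. A j) = {}"
      using infinite_subset_avoiding[OF d A] by metis
    with k show "\<exists>y. infinite (snd y) \<and> fst y \<in> snd x \<and> snd y \<subseteq> snd x - {..fst y} \<and>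
       members (d (\<nu> (fst y))) (\<Union>j\<in>snd y. A j) = {} \<and>
       (\<forall>j\<in>snd y. even (card (members (d (\<nu> j)) (A (fst y)))))"
      by (intro exI[of _ "(k, M')"]) auto
  qed
  then obtain f where
    f: "\<And>m. fst (f (Suc m)) \<in> snd (f m)" "\<And>m. snd (f (Suc m)) \<subseteq> snd (f m) - {..fst (f (Suc m))}"
      "\<And>m. members (d (\<nu> (fst (f (Suc m))))) (\<Union>j\<in>snd (f (Suc m)). A j) = {}"
      "\<And>m j. j \<in> snd (f (Suc m)) \<Longrightarrow> even (card (members (d (\<nu> j)) (A (fst (f (Suc m))))))" by blast
  \<comment> \<open>With \<open>B\<close> the union of the selected pieces \<open>A (K m)\<close>, the earlier pieces contribute evenly to
    \<open>d (\<nu> (K m))\<close> and the union of the later ones contributes nothing.\<close>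
  define K where "K m = fst (f (Suc m))" for m
  define M where "M m = snd (f (Suc m))" for m
  have anti: "M n \<subseteq> M m" if "m \<le> n" for m n
  proof (rule lift_Suc_antimono_le[of M, OF _ that])
    show "M (Suc m) \<subseteq> M m" for m using f(2)[of "Suc m"] by (auto simp: M_def)
  qed
  have KM: "K n \<in> M m" if "m < n" for m n
    using anti[of m "n - 1"] f(1)[of n] that by (cases n) (auto simp: K_def M_def)
  have "K m < K (Suc m)" for m
    using KM[of m "Suc m"] f(2)[of m] by (auto simp: K_def M_def)
  then have K: "strict_mono K" by (simp add: strict_mono_Suc_iff)
  define B where "B = (\<Union>m. A (K m))"
  have "odd (card (members (d (\<nu> (K m))) B))" for m
  proof -
    let ?d = "d (\<nu> (K m))"
    let ?L = "\<Union>l\<in>{..<m}. A (K l)" and ?G = "\<Union>l\<in>{m<..}. A (K l)"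
    have disj: "A (K l) \<inter> A (K l') = {}" if "l \<noteq> l'" for l l'
      using A that K by (metis disjoint_family_onD iso_tuple_UNIV_I strict_mono_eq)
    have "?G \<subseteq> (\<Union>j\<in>M m. A j)" using KM by auto
    then have G: "members ?d ?G = {}"
      using members_mono[of ?G "\<Union>j\<in>M m. A j" ?d] f(3)[of m] by (auto simp: K_def M_def)
    have L: "even (card (members ?d ?L))"
    proof (rule even_members_UN)
      show "disjoint_family_on (\<lambda>l. A (K l)) {..<m}"
        using disj by (auto simp: disjoint_family_on_def)
      show "even (card (members ?d (A (K j))))" if "j \<in> {..<m}" for j
        using f(4)[of "K m" j] KM[of j m] that by (simp add: K_def M_def)
    qed (use d in auto)
    have "members ?d B = members ?d (A (K m) \<union> ?L)"
    proof -
      have "UNIV = {m} \<union> {..<m} \<union> {m<..}" by auto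
      then have "B = (\<Union>l\<in>{m} \<union> {..<m} \<union> {m<..}. A (K l))" unfolding B_def by simp
      also have "\<dots> = (A (K m) \<union> ?L) \<union> ?G" by (simp only: UN_Un UN_insert UN_empty Un_empty_right)
      finally have "B = (A (K m) \<union> ?L) \<union> ?G" .
      then have "members ?d B = members ?d (A (K m) \<union> ?L) \<union> members ?d ?G"
        using members_Un[of ?d "A (K m) \<union> ?L" ?G] d(2) by simp
      with G show ?thesis by simp
    qed
    also have "card \<dots> = card (members ?d (A (K m))) + card (members ?d ?L)"
    proof (rule card_members_Un[OF d])
      have "A (K m) \<inter> A (K l) = {}" if "l < m" for l using disj that by simp
      then show "A (K m) \<inter> ?L = {}" by blast
    qed
    finally show ?thesis using L odd[of "K m"] by simp
  qed
  moreover have "\<forall>\<^sub>\<infinity>m. even (card (members (d (\<nu> (K m))) B))"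
    using ev\<nu>[of B] filterlim_subseq[OF K] unfolding cofinite_eq_sequentially
    by (rule eventually_compose_filterlim)
  ultimately show False by simp
qed

end

section \<open>Homomorphisms from the free Boolean group\<close>

text \<open>
  A pair \<open>(U, p)\<close> stands for the point \<open>p\<close> of a copy, indexed by \<open>U\<close>, of the space of
  ultrafilters, and \<open>eventually (f U) p\<close> is the value at \<open>p\<close> of the continuous extension of \<open>f U\<close>.
  So \<open>parity f\<close> is a homomorphism from the free Boolean group over all these points to the
  two-element group.
\<close>

definition parity :: "('a \<Rightarrow> 'b \<Rightarrow> bool) \<Rightarrow> ('a \<times> 'b filter) set \<Rightarrow> bool" where
  "parity f S \<longleftrightarrow> odd (card {s \<in> S. eventually (f (fst s)) (snd s)})"

lemma parity_cong:
  "(\<And>U p. (U, p) \<in> S \<Longrightarrow> f U = g U) \<Longrightarrow> parity f S = parity g S"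
  unfolding parity_def by (metis (mono_tags, lifting) Collect_cong prod.collapse)

lemma parity_empty [simp]: "\<not> parity f {}"
  by (simp add: parity_def)

lemma parity_singleton [simp]: "parity f {(U, p)} \<longleftrightarrow> eventually (f U) p"
proof (cases "eventually (f U) p")
  case True
  then have "{s \<in> {(U, p)}. eventually (f (fst s)) (snd s)} = {(U, p)}" by auto
  with True show ?thesis by (simp add: parity_def)
next
  case False
  then have "{s \<in> {(U, p)}. eventually (f (fst s)) (snd s)} = {}" by auto
  with False show ?thesis unfolding parity_def by (simp only: card.empty) simp
qed

lemma odd_card_sym_diff:
  assumes "finite A" "finite B"
  shows "odd (card (sym_diff A B)) \<longleftrightarrow> odd (card A) \<noteq> odd (card B)"
proof -
  have "card (sym_diff A B) = card (A - B) + card (B - A)"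
    using assms by (intro card_Un_disjoint) auto
  moreover have "card A = card (A - B) + card (A \<inter> B)" "card B = card (B - A) + card (A \<inter> B)"
    using card_Int_Diff[OF assms(1), of B] card_Int_Diff[OF assms(2), of A]
    by (simp_all add: Int_commute)
  ultimately show ?thesis by auto
qed

lemma parity_sym_diff:
  assumes "finite S" "finite T"
  shows "parity f (sym_diff S T) \<longleftrightarrow> parity f S \<noteq> parity f T"
proof -
  let ?P = "\<lambda>s. eventually (f (fst s)) (snd s)"
  have "{s \<in> sym_diff S T. ?P s} = sym_diff {s \<in> S. ?P s} {s \<in> T. ?P s}" by auto
  then show ?thesis using assms by (simp add: parity_def odd_card_sym_diff)
qed

text \<open>All copies are merged into the ultrafilters on pairs, and
  \<open>infinitely_often_odd\<close> is applied to the symmetric differences of consecutive terms.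
  An odd count for such a difference means that the value of the homomorphism changes there.\<close>

lemma parity_fluctuates:
  fixes S :: "nat \<Rightarrow> ('a \<times> 'b filter) set"
  assumes S: "\<And>n. finite (S n)" "\<And>n. S n \<subseteq> UNIV \<times> Collect ultrafilter"
    and inf: "\<exists>\<^sub>\<infinity>n. S n \<noteq> S (Suc n)"
  shows "\<exists>f. \<exists>\<^sub>\<infinity>n. parity f (S n) \<noteq> parity f (S (Suc n))"
proof -
  \<comment> \<open>\<open>G\<close> places the copy with index \<open>U\<close> on the fibre over
    \<open>U\<close>. The fibre belongs to the image ultrafilter, so \<open>U\<close> can be
    recovered from it.\<close>
  define G :: "'a \<times> 'b filter \<Rightarrow> ('a \<times> 'b) filter" where "G = (\<lambda>(U, p). filtermap (Pair U) p)"
  have G: "eventually P (G (U, p)) \<longleftrightarrow> eventually (\<lambda>n. P (U, n)) p" for P U p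
    by (simp add: G_def eventually_filtermap)
  have inj: "inj_on G (UNIV \<times> Collect ultrafilter)"
  proof (rule inj_onI, clarify)
    fix U V and p q :: "'b filter"
    assume u: "ultrafilter p" "ultrafilter q" and eq: "G (U, p) = G (V, q)"
    have "eventually (\<lambda>x. fst x = U) (G (U, p))" by (simp add: G)
    then have "eventually (\<lambda>x. V = U) q" unfolding eq by (simp add: G)
    then have UV: "U = V" using u(2) by (cases "U = V") (auto simp: ultrafilter_def)
    have "eventually P p = eventually P q" for P
      using G[of "\<lambda>x. P (snd x)" U p] G[of "\<lambda>x. P (snd x)" V q] eq by simp
    with UV show "U = V \<and> p = q" by (simp add: filter_eq_iff)
  qed
  define D where "D n = sym_diff (S n) (S (Suc n))" for n
  have D: "finite (D n)" "D n \<subseteq> UNIV \<times> Collect ultrafilter" for n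
    using S[of n] S[of "Suc n"] by (auto simp: D_def)
  have "\<exists>A. \<exists>\<^sub>\<infinity>n. odd (card (members (G ` D n) A))"
  proof (rule infinitely_often_odd)
    show "G ` D n \<subseteq> Collect ultrafilter" for n
      using D(2)[of n] ultrafilter_filtermap by (fastforce simp: G_def)
    have "D n \<noteq> {}" if "S n \<noteq> S (Suc n)" for n using that by (auto simp: D_def)
    with inf show "\<exists>\<^sub>\<infinity>n. G ` D n \<noteq> {}" by (auto elim!: frequently_elim1)
  qed (use D in simp)
  then obtain A where A: "\<exists>\<^sub>\<infinity>n. odd (card (members (G ` D n) A))" by blast
  \<comment> \<open>The fibre of \<open>A\<close> over \<open>U\<close> prescribes the values on the
    copy with index \<open>U\<close>.\<close>
  define f where "f = (\<lambda>U n. (U, n) \<in> A)"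
  have "odd (card (members (G ` D n) A)) \<longleftrightarrow> parity f (S n) \<noteq> parity f (S (Suc n))" for n
  proof -
    have "members (G ` D n) A = G ` {s \<in> D n. eventually (f (fst s)) (snd s)}"
    proof -
      have "eventually (\<lambda>x. x \<in> A) (G s) \<longleftrightarrow> eventually (f (fst s)) (snd s)" for s
        using G[of "\<lambda>x. x \<in> A" "fst s" "snd s"] by (simp add: f_def)
      then show ?thesis by (auto simp: members_def)
    qed
    moreover have "inj_on G {s \<in> D n. eventually (f (fst s)) (snd s)}"
      using inj by (rule inj_on_subset) (use D(2) in auto)
    ultimately have "card (members (G ` D n) A) = card {s \<in> D n. eventually (f (fst s)) (snd s)}"
      by (simp add: card_image)
    then have "odd (card (members (G ` D n) A)) \<longleftrightarrow> parity f (D n)" by (simp add: parity_def)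
    then show ?thesis unfolding D_def using parity_sym_diff[OF S(1) S(1)] by simp
  qed
  with A show ?thesis by (intro exI[of _ f]) simp
qed

section \<open>Types of cardinality at most 2^c\<close>

text \<open>\<open>real set\<close> has cardinality 2^c and later serves as the type of
  coordinates.\<close>

definition small_type :: "'a itself \<Rightarrow> bool" where
  "small_type _ \<longleftrightarrow> (\<exists>f :: 'a \<Rightarrow> real set. inj f)"

lemma small_typeI: "inj (f :: 'a \<Rightarrow> real set) \<Longrightarrow> small_type TYPE('a)"
  by (auto simp: small_type_def)

lemma small_type_inj:
  assumes "inj (f :: 'a \<Rightarrow> 'b)" "small_type TYPE('b)"
  shows "small_type TYPE('a)"
proof -
  obtain g :: "'b \<Rightarrow> real set" where "inj g" using assms(2) by (auto simp: small_type_def)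
  then have "inj (g \<circ> f)" using assms(1) by (rule inj_compose)
  then show ?thesis by (rule small_typeI)
qed

lemma ex_inj_infinite_Times:
  assumes "infinite (UNIV :: 'a set)"
  shows "\<exists>f :: 'a \<times> 'a \<Rightarrow> 'a. inj f"
proof -
  have "(UNIV :: 'a set) \<times> (UNIV :: 'a set) \<approx> (UNIV :: 'a set)"
    unfolding eqpoll_iff_card_of_ordIso using assms by (rule card_of_Times_same_infinite)
  then obtain f :: "'a \<times> 'a \<Rightarrow> 'a" where "bij_betw f (UNIV \<times> UNIV) UNIV"
    unfolding eqpoll_def by blast
  then have "inj f" by (simp add: bij_betw_def)
  then show ?thesis by blast
qed

lemma small_type_prod:
  assumes "small_type TYPE('a)" "small_type TYPE('b)"
  shows "small_type TYPE('a \<times> 'b)"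
proof -
  obtain f :: "'a \<Rightarrow> real set" and g :: "'b \<Rightarrow> real set" where fg: "inj f" "inj g"
    using assms by (auto simp: small_type_def)
  have "infinite (UNIV :: real set set)"
    by (simp add: Finite_Set.finite_set infinite_UNIV_char_0)
  then obtain h :: "real set \<times> real set \<Rightarrow> real set" where h: "inj h"
    using ex_inj_infinite_Times by blast
  show ?thesis
  proof (rule small_type_inj)
    show "inj (map_prod f g)" using fg by (rule prod.inj_map)
    show "small_type TYPE(real set \<times> real set)" using h by (rule small_typeI)
  qed
qed

lemma small_type_bool: "small_type TYPE(bool)"
  by (rule small_typeI[of "\<lambda>b. if b then UNIV else {}"]) (auto intro!: injI split: if_splits)

lemma small_type_nat: "small_type TYPE(nat)"
  by (rule small_typeI[of "\<lambda>n. {real n}"]) (auto intro!: injI)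

lemma small_type_real_set: "small_type TYPE(real set)"
  by (rule small_typeI[of id]) simp

text \<open>A sequence of sets of reals amounts to a subset of \<nat> \<times> \<real>, which
  \<open>h\<close> codes as a set of reals.\<close>

lemma small_type_seq:
  assumes "small_type TYPE('a)"
  shows "small_type TYPE(nat \<Rightarrow> 'a)"
proof -
  obtain g :: "'a \<Rightarrow> real set" where g: "inj g" using assms by (auto simp: small_type_def)
  obtain h :: "real \<times> real \<Rightarrow> real" where h: "inj h"
    using ex_inj_infinite_Times[OF infinite_UNIV_char_0] by blast
  define code where "code f = {y. \<exists>n x. y = h (real n, x) \<and> x \<in> g (f n)}" for f :: "nat \<Rightarrow> 'a"
  have code: "h (real n, x) \<in> code f \<longleftrightarrow> x \<in> g (f n)" for n x f
    by (auto simp: code_def inj_eq[OF h])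
  have "inj code"
  proof (rule injI, rule ext)
    fix f f' :: "nat \<Rightarrow> 'a" and n
    assume eq: "code f = code f'"
    have "g (f n) = g (f' n)"
    proof (rule Set.set_eqI)
      show "x \<in> g (f n) \<longleftrightarrow> x \<in> g (f' n)" for x
        unfolding code[symmetric] eq ..
    qed
    then show "f n = f' n" using g by (simp add: inj_eq)
  qed
  then show ?thesis by (rule small_typeI)
qed

lemma small_type_list:
  assumes "small_type TYPE('a)"
  shows "small_type TYPE('a list)"
proof (rule small_type_inj)
  \<comment> \<open>\<open>xs ! n\<close> has no specified value past the end, so the length is
    recorded too.\<close>
  show "inj (\<lambda>xs :: 'a list. (length xs, \<lambda>n. xs ! n))"
    by (rule injI) (auto intro!: nth_equalityI dest: fun_cong)
  show "small_type TYPE(nat \<times> (nat \<Rightarrow> 'a))"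
    using assms by (intro small_type_prod small_type_nat small_type_seq)
qed

text \<open>A filter is determined by the family of its sets, and each set of naturals is coded by
  one real.\<close>

lemma small_type_nat_filter: "small_type TYPE(nat filter)"
proof -
  obtain h :: "nat set \<Rightarrow> real" where h: "inj h"
    using nat_sets_eqpoll_reals by (auto simp: eqpoll_def bij_betw_def)
  have "inj (\<lambda>p :: nat filter. h ` {A. eventually (\<lambda>n. n \<in> A) p})"
  proof (rule injI)
    fix p q :: "nat filter"
    assume "h ` {A. eventually (\<lambda>n. n \<in> A) p} = h ` {A. eventually (\<lambda>n. n \<in> A) q}"
    then have eq: "{A. eventually (\<lambda>n. n \<in> A) p} = {A. eventually (\<lambda>n. n \<in> A) q}"
      using h by (simp add: inj_image_eq_iff)
    have "eventually P p \<longleftrightarrow> eventually P q" for P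
    proof -
      have "Collect P \<in> {A. eventually (\<lambda>n. n \<in> A) p} \<longleftrightarrow>
            Collect P \<in> {A. eventually (\<lambda>n. n \<in> A) q}" by (simp only: eq)
      then show ?thesis by simp
    qed
    then show "p = q" by (simp add: filter_eq_iff)
  qed
  then show ?thesis by (rule small_typeI)
qed

lemma uncountable_real_sets: "uncountable (UNIV :: real set set)"
proof
  assume "countable (UNIV :: real set set)"
  then have "countable (range (\<lambda>x :: real. {x}))" by (rule countable_subset[rotated]) simp
  then have "countable (UNIV :: real set)" by (rule countable_image_inj_on) simp
  with uncountable_UNIV_real show False by simp
qed

section \<open>Assigning homomorphisms to coordinates\<close>

text \<open>
  A list \<open>L\<close> encodes the basic open set of all points whose \<open>k\<close>-th coordinate is \<open>b\<close> whenever
  \<open>map_of L k = Some b\<close>. The value \<open>c k U n\<close> below is the \<open>k\<close>-th coordinate of the point chosen in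
  the \<open>n\<close>-th basic open set of the sequence \<open>U\<close>.
\<close>

type_synonym box_seq = "nat \<Rightarrow> (real set \<times> bool) list"

text \<open>The injection \<open>\<phi>\<close> reserves 2^c coordinates for every sequence of
  finite sets. The boxes of the copies occurring in the sequence restrict only countably many
  coordinates, so at some reserved one a homomorphism from \<open>parity_fluctuates\<close> acts
  unchanged on these copies.\<close>

lemma ex_coordinate_values:
  "\<exists>c :: real set \<Rightarrow> box_seq \<Rightarrow> nat \<Rightarrow> bool.
     (\<forall>k U n b. map_of (U n) k = Some b \<longrightarrow> c k U n = b) \<and>
     (\<forall>S. (\<forall>n. finite (S n) \<and> S n \<subseteq> UNIV \<times> Collect ultrafilter) \<and>
        (\<exists>\<^sub>\<infinity>n. S n \<noteq> S (Suc n)) \<longrightarrow>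
        (\<exists>k. \<exists>\<^sub>\<infinity>n. parity (c k) (S n) \<noteq> parity (c k) (S (Suc n))))"
proof -
  \<comment> \<open>Finite sets are represented by lists for counting; the factor
    \<open>real set\<close> supplies the many coordinates reserved for one sequence.\<close>
  have "small_type TYPE((nat \<Rightarrow> (box_seq \<times> nat filter) list) \<times> real set)"
    by (intro small_type_prod small_type_seq small_type_list small_type_bool
        small_type_nat_filter small_type_real_set)
  then obtain \<phi> :: "(nat \<Rightarrow> (box_seq \<times> nat filter) list) \<times> real set \<Rightarrow> real set" where \<phi>: "inj \<phi>"
    by (auto simp: small_type_def)
  define fluct where "fluct S f \<longleftrightarrow> (\<exists>\<^sub>\<infinity>n. parity f (S n) \<noteq> parity f (S (Suc n)))"
    for S :: "nat \<Rightarrow> (box_seq \<times> nat filter) set" and f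
  define F where "F s = (SOME f. fluct (\<lambda>n. set (s n)) f)"
    for s :: "nat \<Rightarrow> (box_seq \<times> nat filter) list"
  \<comment> \<open>The boxes take precedence; elsewhere coordinate \<open>k\<close> follows the
    homomorphism chosen for the sequence coded by \<open>k\<close>. Outside the range of
    \<open>\<phi>\<close> the sequence is arbitrary.\<close>
  define c where "c k U n = (case map_of (U n) k of Some b \<Rightarrow> b
      | None \<Rightarrow> F (fst (inv_into UNIV \<phi> k)) U n)" for k and U :: box_seq and n
  show ?thesis
  proof (intro exI[of _ c] conjI allI impI)
    show "c k U n = b" if "map_of (U n) k = Some b" for k U n b
      using that by (simp add: c_def)
  next
    fix S :: "nat \<Rightarrow> (box_seq \<times> nat filter) set"
    assume "(\<forall>n. finite (S n) \<and> S n \<subseteq> UNIV \<times> Collect ultrafilter) \<and>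
      (\<exists>\<^sub>\<infinity>n. S n \<noteq> S (Suc n))"
    then have S: "\<And>n. finite (S n)" "\<And>n. S n \<subseteq> UNIV \<times> Collect ultrafilter"
      "\<exists>\<^sub>\<infinity>n. S n \<noteq> S (Suc n)" by blast+
    have "\<forall>n. \<exists>xs. set xs = S n" using S(1) finite_list by blast
    then obtain s where s: "\<And>n. set (s n) = S n" by metis
    have "\<exists>f. fluct S f" unfolding fluct_def using parity_fluctuates[OF S] .
    then have F: "fluct S (F s)" unfolding F_def s by (rule someI_ex)
    \<comment> \<open>The coordinates restricted by some box of some copy that occurs in the
      sequence.\<close>
    define supp where "supp = (\<Union>n. \<Union>u\<in>fst ` S n. \<Union>m. fst ` set (u m))"
    have "countable (fst ` S n)" for n using S(1) by (simp add: countable_finite)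
    then have "countable supp"
      unfolding supp_def by (intro countable_UN) (simp_all add: countable_finite)
    moreover have "uncountable (range (\<lambda>t. \<phi> (s, t)))"
    proof
      assume "countable (range (\<lambda>t. \<phi> (s, t)))"
      then have "countable (UNIV :: real set set)"
        by (rule countable_image_inj_on) (auto intro!: injI dest: injD[OF \<phi>])
      with uncountable_real_sets show False by simp
    qed
    ultimately have "\<not> range (\<lambda>t. \<phi> (s, t)) \<subseteq> supp" using countable_subset by metis
    then obtain t where t: "\<phi> (s, t) \<notin> supp" by blast
    have "c (\<phi> (s, t)) U = F s U" if "(U, p) \<in> S n" for U p n
    proof
      fix m
      have "\<phi> (s, t) \<notin> fst ` set (U m)" using t that by (force simp: supp_def)
      then have "map_of (U m) (\<phi> (s, t)) = None" by (simp add: map_of_eq_None_iff)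
      then show "c (\<phi> (s, t)) U m = F s U m" using \<phi> by (simp add: c_def)
    qed
    then have "parity (c (\<phi> (s, t))) (S n) = parity (F s) (S n)" for n
      by (rule parity_cong)
    with F show "\<exists>k. \<exists>\<^sub>\<infinity>n. parity (c k) (S n) \<noteq> parity (c k) (S (Suc n))"
      by (intro exI[of _ "\<phi> (s, t)"]) (simp add: fluct_def)
  qed
qed

section \<open>The subgroup of the power of the two-element group\<close>

lemma in_carrier_Z2: "x \<in> carrier Z2_group \<longleftrightarrow> x = 0 \<or> x = 1"
  by (auto simp: carrier_integer_mod_group)

text \<open>\<open>L\<close> records the values of \<open>z\<close> at the finitely many coordinates
  restricted by a basic neighbourhood of \<open>z\<close> inside \<open>W\<close>. The injection
  \<open>e\<close> renames the indices, since boxes will be written over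
  \<open>real set\<close>.\<close>

lemma Z2_power_basic_open:
  fixes e :: "'i \<Rightarrow> 'k"
  assumes "openin (Z2_power_top I) W" "z \<in> W" "inj_on e I"
  shows "\<exists>L. \<forall>x \<in> topspace (Z2_power_top I).
           (\<forall>i\<in>I. \<forall>b. map_of L (e i) = Some b \<longrightarrow> x i = of_bool b) \<longrightarrow> x \<in> W"
proof -
  have "\<exists>V. finite {i \<in> I. V i \<noteq> topspace (discrete_topology (carrier Z2_group))} \<and>
      (\<forall>i\<in>I. openin (discrete_topology (carrier Z2_group)) (V i)) \<and> z \<in> Pi\<^sub>E I V \<and> Pi\<^sub>E I V \<subseteq> W"
    using assms(1,2) unfolding openin_product_topology_alt by blast
  then obtain V where V: "finite {i \<in> I. V i \<noteq> carrier Z2_group}" "z \<in> Pi\<^sub>E I V" "Pi\<^sub>E I V \<subseteq> W"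
    by auto
  obtain ks where ks: "set ks = {i \<in> I. V i \<noteq> carrier Z2_group}"
    using finite_list[OF V(1)] by blast
  define L where "L = map (\<lambda>i. (e i, z i = 1)) ks"
  have z: "z \<in> topspace (Z2_power_top I)"
    using assms(1,2) openin_subset by blast
  have L: "map_of L (e i) = Some (z i = 1)" if i: "i \<in> I" "V i \<noteq> carrier Z2_group" for i
  proof -
    \<comment> \<open>\<open>ks\<close> may have repetitions, but by injectivity of \<open>e\<close>
      all entries of \<open>L\<close> with key \<open>e i\<close> carry the same value.\<close>
    have "map_of L (e i) \<noteq> None"
      using i ks by (force simp: L_def map_of_eq_None_iff)
    then obtain b where b: "map_of L (e i) = Some b" by blast
    then have "(e i, b) \<in> set L" by (rule map_of_SomeD)
    then obtain j where j: "j \<in> set ks" "e i = e j" "b \<longleftrightarrow> z j = 1" by (auto simp: L_def)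
    then have "i = j" using assms(3) i ks by (auto dest: inj_onD)
    with b j show ?thesis by simp
  qed
  have "x \<in> W" if x: "x \<in> topspace (Z2_power_top I)"
    and agree: "\<forall>i\<in>I. \<forall>b. map_of L (e i) = Some b \<longrightarrow> x i = of_bool b" for x
  proof -
    have "x i \<in> V i" if i: "i \<in> I" for i
    proof (cases "V i = carrier Z2_group")
      case True
      then show ?thesis using x i by (auto simp: PiE_iff)
    next
      case False
      have "z i \<in> carrier Z2_group" using z i by (auto simp: PiE_iff)
      then have "x i = z i" using agree i L[OF i False] by (auto simp: in_carrier_Z2)
      then show ?thesis using V(2) i by (auto simp: PiE_iff)
    qed
    then have "x \<in> Pi\<^sub>E I V" using x by (auto simp: PiE_iff)
    with V(3) show ?thesis by blast
  qed
  then show ?thesis by blast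
qed

definition point :: "'i set \<Rightarrow> ('i \<Rightarrow> 'a \<Rightarrow> 'b \<Rightarrow> bool) \<Rightarrow> ('a \<times> 'b filter) set \<Rightarrow> 'i \<Rightarrow> int" where
  "point I c S = (\<lambda>i\<in>I. of_bool (parity (c i) S))"

text \<open>Finite sets under symmetric difference form the free Boolean group; this is its
  image.\<close>

definition point_group :: "'i set \<Rightarrow> ('i \<Rightarrow> 'a \<Rightarrow> 'b \<Rightarrow> bool) \<Rightarrow> ('i \<Rightarrow> int) set" where
  "point_group I c = point I c ` {S. finite S \<and> S \<subseteq> UNIV \<times> Collect ultrafilter}"

lemma point_in_topspace [simp]: "point I c S \<in> topspace (Z2_power_top I)"
  by (simp add: point_def in_carrier_Z2)

lemma point_group_subset: "point_group I c \<subseteq> topspace (Z2_power_top I)"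
  using point_in_topspace by (auto simp only: point_group_def)

lemma point_in_group:
  "finite S \<Longrightarrow> S \<subseteq> UNIV \<times> Collect ultrafilter \<Longrightarrow> point I c S \<in> point_group I c"
  by (simp add: point_group_def)

lemma point_mult:
  assumes "finite S" "finite T"
  shows "point I c S \<otimes>\<^bsub>Z2_power_group I\<^esub> point I c T = point I c (sym_diff S T)"
  by (rule ext) (simp add: point_def parity_sym_diff[OF assms])

text \<open>Products correspond to symmetric differences, and every element is its own
  inverse.\<close>

lemma subgroup_point_group: "subgroup (point_group I c) (Z2_power_group I)"
proof -
  interpret G: group "Z2_power_group I" by simp
  have one: "point I c {} = \<one>\<^bsub>Z2_power_group I\<^esub>"
    by (rule ext) (simp add: point_def)
  have carrier: "point_group I c \<subseteq> carrier (Z2_power_group I)"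
    using point_group_subset[of I c] by simp
  show ?thesis
  proof (rule G.subgroupI[OF carrier])
    show "point_group I c \<noteq> {}" using point_in_group[of "{}"] by blast
  next
    fix a assume "a \<in> point_group I c"
    then obtain S where S: "finite S" "a = point I c S" by (auto simp: point_group_def)
    have "a \<otimes>\<^bsub>Z2_power_group I\<^esub> a = \<one>\<^bsub>Z2_power_group I\<^esub>"
      unfolding S(2) point_mult[OF S(1) S(1)] by (simp only: Diff_cancel Un_empty_left one)
    then have "inv\<^bsub>Z2_power_group I\<^esub> a = a"
      using \<open>a \<in> point_group I c\<close> carrier by (intro G.inv_equality) auto
    then show "inv\<^bsub>Z2_power_group I\<^esub> a \<in> point_group I c"
      using \<open>a \<in> point_group I c\<close> by simp
  next
    fix a b assume "a \<in> point_group I c" "b \<in> point_group I c"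
    then obtain S T where S: "finite S" "S \<subseteq> UNIV \<times> Collect ultrafilter" "a = point I c S"
      and T: "finite T" "T \<subseteq> UNIV \<times> Collect ultrafilter" "b = point I c T"
      unfolding point_group_def by blast
    have "sym_diff S T \<subseteq> UNIV \<times> Collect ultrafilter" using S T by blast
    then show "a \<otimes>\<^bsub>Z2_power_group I\<^esub> b \<in> point_group I c"
      unfolding S(3) T(3) point_mult[OF S(1) T(1)] using S(1) T(1) by (intro point_in_group) simp_all
  qed
qed

text \<open>In each coordinate the two-valued sequence \<open>c i U\<close> agrees, on a set in
  \<open>p\<close>, with its limit along \<open>p\<close>, which is the value at
  \<open>(U, p)\<close>.\<close>

lemma limitin_point:
  assumes p: "ultrafilter p"
  shows "limitin (Z2_power_top I) (\<lambda>n. point I c {(U, principal {n})}) (point I c {(U, p)}) p"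
  unfolding limitin_componentwise
proof (intro conjI ballI)
  show "point I c {(U, p)} \<in> extensional I" by (simp add: point_def)
  show "eventually (\<lambda>n. point I c {(U, principal {n})} \<in> topspace (Z2_power_top I)) p"
    by (simp only: point_in_topspace eventually_True)
  fix i assume i: "i \<in> I"
  have "eventually (\<lambda>n. c i U n \<longleftrightarrow> eventually (c i U) p) p"
    using ultrafilter_not[OF p, of "c i U"] by (cases "eventually (c i U) p") simp_all
  then have "eventually (\<lambda>n. point I c {(U, principal {n})} i = point I c {(U, p)} i) p"
    by eventually_elim (simp add: point_def i eventually_principal)
  then show "limitin (discrete_topology (carrier Z2_group))
      (\<lambda>n. point I c {(U, principal {n})} i) (point I c {(U, p)} i) p"
    unfolding limitin_def
  proof (intro conjI allI impI)
    show "point I c {(U, p)} i \<in> topspace (discrete_topology (carrier Z2_group))"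
      by (simp add: point_def i in_carrier_Z2)
  qed (auto elim: eventually_mono)
qed

text \<open>A convergent sequence in a discrete space is eventually constant. Comparing consecutive
  terms makes this directly contradict the fluctuation of parities.\<close>

lemma limitin_Z2_coordinate:
  assumes "limitin (Z2_power_top I) x l sequentially" "i \<in> I"
  shows "eventually (\<lambda>n. x n i = x (Suc n) i) sequentially"
proof -
  have lim: "limitin (discrete_topology (carrier Z2_group)) (\<lambda>n. x n i) (l i) sequentially"
    using assms by (simp add: limitin_componentwise)
  then have "l i \<in> carrier Z2_group" by (auto simp: limitin_def)
  then have "openin (discrete_topology (carrier Z2_group)) {l i}" by simp
  with lim have "eventually (\<lambda>n. x n i \<in> {l i}) sequentially"
    unfolding limitin_def by blast
  then have "eventually (\<lambda>n. x n i = l i) sequentially" by simp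
  moreover from this have "eventually (\<lambda>n. x (Suc n) i = l i) sequentially"
    by (subst eventually_sequentially_Suc)
  ultimately show ?thesis by eventually_elim simp
qed

section \<open>Density, pseudocompactness and convergent sequences\<close>

theorem corollary1p3:
  fixes I :: "'i set"
  assumes "I \<approx> Pow (UNIV :: real set)"
  shows "\<exists>H. subgroup H (Z2_power_group I)
           \<and> Z2_power_top I closure_of H = topspace (Z2_power_top I)
           \<and> strongly_free_pseudocompact (subtopology (Z2_power_top I) H)
           \<and> \<not> has_nontrivial_convergent_sequence (subtopology (Z2_power_top I) H)"
proof -
  obtain e :: "'i \<Rightarrow> real set" where e: "inj_on e I" "e ` I = UNIV"
    using assms by (auto simp: eqpoll_def bij_betw_def)
  obtain c :: "real set \<Rightarrow> box_seq \<Rightarrow> nat \<Rightarrow> bool"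
    where c: "\<forall>k U n b. map_of (U n) k = Some b \<longrightarrow> c k U n = b"
    and fluct: "\<forall>S. (\<forall>n. finite (S n) \<and> S n \<subseteq> UNIV \<times> Collect ultrafilter) \<and>
        (\<exists>\<^sub>\<infinity>n. S n \<noteq> S (Suc n)) \<longrightarrow>
        (\<exists>k. \<exists>\<^sub>\<infinity>n. parity (c k) (S n) \<noteq> parity (c k) (S (Suc n)))"
    using ex_coordinate_values by (elim exE conjE)
  let ?c = "\<lambda>i. c (e i)"
  let ?X = "Z2_power_top I" and ?H = "point_group I (\<lambda>i. c (e i))"
  \<comment> \<open>Take for \<open>U\<close> a sequence of boxes inside the sets
    \<open>W n\<close>; by the choice of \<open>c\<close>, the image of \<open>(U, n)\<close> lies
    in the \<open>n\<close>-th box. Constant \<open>W\<close> gives density, general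
    \<open>W\<close> gives pseudocompactness.\<close>
  have approx: "\<exists>U. \<forall>n. point I ?c {(U, principal {n})} \<in> W n"
    if W: "\<And>n :: nat. openin ?X (W n)" "\<And>n. W n \<noteq> {}" for W :: "nat \<Rightarrow> ('i \<Rightarrow> int) set"
  proof -
    have "\<exists>L. \<forall>x \<in> topspace ?X. (\<forall>i\<in>I. \<forall>b. map_of L (e i) = Some b \<longrightarrow> x i = of_bool b) \<longrightarrow> x \<in> W n" for n
      using Z2_power_basic_open[OF W(1) _ e(1)] W(2)[of n] by blast
    then obtain U where U: "\<And>n x. x \<in> topspace ?X \<Longrightarrow>
        (\<forall>i\<in>I. \<forall>b. map_of (U n) (e i) = Some b \<longrightarrow> x i = of_bool b) \<Longrightarrow> x \<in> W n" by metis
    have "point I ?c {(U, principal {n})} \<in> W n" for n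
      by (rule U[OF point_in_topspace]) (auto simp: point_def eventually_principal c)
    then show ?thesis by blast
  qed
  have gen: "point I ?c {(U, p)} \<in> ?H" if "ultrafilter p" for U p
    using that by (intro point_in_group) auto
  have "?X closure_of ?H = topspace ?X"
    unfolding dense_intersects_open
  proof (intro allI impI)
    fix W assume "openin ?X W \<and> W \<noteq> {}"
    then obtain U where "\<forall>n. point I ?c {(U, principal {n})} \<in> W"
      using approx[of "\<lambda>_. W"] by blast
    then show "?H \<inter> W \<noteq> {}" using gen[OF ultrafilter_principal] by blast
  qed
  moreover have "strongly_free_pseudocompact (subtopology ?X ?H)"
    unfolding strongly_free_pseudocompact_def strongly_p_pseudocompact_def
  proof (intro allI impI)
    fix p and V :: "nat \<Rightarrow> ('i \<Rightarrow> int) set"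
    assume "free_ultrafilter p"
    then have p: "ultrafilter p" by (rule free_imp_ultrafilter)
    assume "\<forall>n. openin (subtopology ?X ?H) (V n) \<and> V n \<noteq> {}"
    then have "\<forall>n. \<exists>W. openin ?X W \<and> V n = W \<inter> ?H \<and> W \<noteq> {}"
      unfolding openin_subtopology by blast
    then obtain W where W: "\<And>n. openin ?X (W n)" "\<And>n. V n = W n \<inter> ?H" "\<And>n. W n \<noteq> {}" by metis
    obtain U where U: "\<And>n. point I ?c {(U, principal {n})} \<in> W n"
      using approx[of W, OF W(1,3)] by blast
    \<comment> \<open>The limit stays in the group because the copy with index \<open>U\<close>
      contains the point \<open>p\<close> as well.\<close>
    have "limitin (subtopology ?X ?H) (\<lambda>n. point I ?c {(U, principal {n})}) (point I ?c {(U, p)}) p"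
      unfolding limitin_subtopology
      by (intro conjI always_eventually allI limitin_point gen ultrafilter_principal p)
    moreover have "\<forall>n. point I ?c {(U, principal {n})} \<in> V n"
      using U W(2) gen[OF ultrafilter_principal] by blast
    ultimately show "\<exists>x. (\<forall>n. x n \<in> V n) \<and> (\<exists>l. limitin (subtopology ?X ?H) x l p)"
      by (intro exI[of _ "\<lambda>n. point I ?c {(U, principal {n})}"] conjI
          exI[of _ "point I ?c {(U, p)}"])
  qed
  moreover have "\<not> has_nontrivial_convergent_sequence (subtopology ?X ?H)"
  proof
    assume "has_nontrivial_convergent_sequence (subtopology ?X ?H)"
    then obtain x l where x: "\<And>n. x n \<in> ?H" and lim: "limitin ?X x l sequentially"
      and nontriv: "\<not> (\<exists>a. eventually (\<lambda>n. x n = a) sequentially)"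
      unfolding has_nontrivial_convergent_sequence_def by (auto simp: limitin_subtopology)
    have "\<forall>n. \<exists>S. finite S \<and> S \<subseteq> UNIV \<times> Collect ultrafilter \<and> x n = point I ?c S"
      using x unfolding point_group_def by blast
    then obtain S where S: "\<And>n. finite (S n)" "\<And>n. S n \<subseteq> UNIV \<times> Collect ultrafilter"
      and xS: "\<And>n. x n = point I ?c (S n)" by metis
    \<comment> \<open>If \<open>S\<close> were eventually constant, its image \<open>x\<close> would
      be too.\<close>
    have "\<exists>\<^sub>\<infinity>n. S n \<noteq> S (Suc n)"
    proof (rule ccontr)
      assume "\<not> ?thesis"
      then have "eventually (\<lambda>n. S n = S (Suc n)) sequentially"
        by (simp add: frequently_def cofinite_eq_sequentially)
      then obtain N where N: "\<And>n. n \<ge> N \<Longrightarrow> S n = S (Suc n)"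
        unfolding eventually_sequentially by blast
      have "S n = S N" if "n \<ge> N" for n
        using that
      proof (induction n rule: dec_induct)
        case (step n)
        then show ?case using N[of n] by metis
      qed simp
      then have "eventually (\<lambda>n. x n = point I ?c (S N)) sequentially"
        unfolding eventually_sequentially xS by metis
      with nontriv show False by blast
    qed
    \<comment> \<open>At this coordinate the values of \<open>x\<close> change infinitely often,
      whereas convergence makes every coordinate eventually constant.\<close>
    then obtain k where k: "\<exists>\<^sub>\<infinity>n. parity (c k) (S n) \<noteq> parity (c k) (S (Suc n))"
      using fluct[rule_format, of S] S by blast
    obtain i where i: "i \<in> I" "e i = k" using e(2) by (metis UNIV_I imageE)
    have "eventually (\<lambda>n. parity (c k) (S n) = parity (c k) (S (Suc n))) sequentially"
      using limitin_Z2_coordinate[OF lim i(1)] by (simp add: xS point_def i of_bool_eq_iff)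
    with k show False by (simp add: frequently_def cofinite_eq_sequentially)
  qed
  ultimately show ?thesis using subgroup_point_group by blast
qed

end
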